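(* For integers $s\geq 1$ and $k\geq 0$ let $T_k(s):=1-2^k+3^k-\cdots+(-1)^{s-1}s^k$. (a) When $s=2t$ is even, then for all integers $m\geq 0$ we have $H_{2m}(T_k(2t))=0$ and $$H_{2m+1}(T_k(2t))=\left(-t^2\right)^{m+1}\prod_{\ell=1}^m\big(\ell^2(t^2-\ell^2)\big)^{2(m+1-\ell)},$$ and in particular, $H_{2m+1}(T_k(2t))=0$ for $m\geq t$. (b) When $s$ is odd, then for all integers $m\geq 0$ we have $$H_{2m}(T_k(s))=\frac{(-1)^m}{m!^2}\prod_{\ell=1}^m\left(\frac{\ell^2}{4}\big(s^2-(2\ell-1)^2\big)\right)^{2(m+1-\ell)},$$ $$H_{2m+1}(T_k(s))=\frac{1}{4^{m+1}}\prod_{\ell=0}^m\frac{\ell!^4}{16^\ell}\big(s^2-(2\ell+1)^2\big)^{2(m-\ell)+1},$$ and $H_{2m}(T_k(s))=0$ when $m\geq(s+1)/2$, while $H_{2m+1}(T_k(s))=0$ when $m\geq(s-1)/2$.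
   Context: For a sequence $(c_0,c_1,\ldots)$ (indexed from $k=0$), $H_n(c_k)=\det\big(c_{i+j}\big)_{0\le i,j\le n}$; here the sequence is taken in the index $k$, with $s$ fixed. $T_k(s)=\sum_{j=1}^{s}(-1)^{j-1}j^k$. Here $m!^2=(m!)^2$, $\ell!^4=(\ell!)^4$, and empty products equal $1$. *)

theory Defs
  imports Complex_Main "Jordan_Normal_Form.Determinant"
begin

(* Note that hankel_det n c is the determinant of a matrix of size n + 1: the indices
   run over 0, ..., n inclusive. *)
definition hankel_det :: "nat \<Rightarrow> (nat \<Rightarrow> 'a::comm_ring_1) \<Rightarrow> 'a" where
  "hankel_det n c = det (mat (n + 1) (n + 1) (\<lambda>(i, j). c (i + j)))"

definition alt_power_sum :: "nat \<Rightarrow> nat \<Rightarrow> real" where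
  "alt_power_sum k s = (\<Sum>j = 1..s. (-1) ^ (j - 1) * real j ^ k)"

end

theory Submission
  imports Defs
begin

text \<open>
  With \<open>x = j - (s + 1) / 2\<close>, the numbers \<open>T_k(s)\<close> are, up to a shift that does not affect Hankel
  determinants, the moments of the signed measure \<open>L\<close> with weight \<open>(-1)^(j-1)\<close> at \<open>x\<close>. It is symmetric
  for odd \<open>s\<close> and antisymmetric for even \<open>s\<close>, so everything reduces to functionals in \<open>y = x^2\<close>.
  If \<open>2 g(x) = Q(x + 1/2) + Q(x - 1/2)\<close>, then \<open>L(g)\<close> telescopes to boundary values of \<open>Q\<close>; this gives
  \<open>L\<close> explicitly on the Newton basis \<open>\<Prod>i<k. (y - (i + a)^2)\<close>, with \<open>a = 0\<close> for \<open>L(f(x^2))\<close> and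
  \<open>a = 1\<close> for \<open>L(x^2 f(x^2))\<close> when \<open>s\<close> is odd, and \<open>a = 1/2\<close> for \<open>L(x f(x^2))\<close> when \<open>s\<close> is even.
  In all three cases the moments are \<open>M \<Prod>i<k. (c^2 - (i + a + 1/2)^2)\<close> with \<open>c = s/2\<close>, and the monic
  orthogonal polynomials are continuous dual Hahn polynomials with known three-term recurrence. In
  the basis formed by \<open>R_i(x^2)\<close> and \<open>x R'_i(x^2)\<close> the Gram matrix is diagonal for odd \<open>s\<close> and
  consists of antidiagonal \<open>2 \<times> 2\<close> blocks for even \<open>s\<close>.
\<close>

section \<open>Hankel determinants and Gram matrices\<close>

text \<open>Favard-type argument, purely algebraic: \<open>F_Suc\<close> determines each row of the
  Gram matrix from the two rows before it, and row 0 is known. \<open>\<gamma> 0 = 0\<close> removes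
  the terms with a truncated index.\<close>

lemma three_term_orthogonality:
  fixes w y :: "'i \<Rightarrow> 'a::comm_ring_1" and P :: "nat \<Rightarrow> 'a \<Rightarrow> 'a"
  assumes rec: "\<And>n x. x * P n x = P (Suc n) x + \<alpha> n * P n x + \<gamma> n * P (n - 1) x"
    and P_0: "\<And>x. P 0 x = 1" and \<gamma>_0: "\<gamma> 0 = 0"
    and sum_0: "\<And>n. n > 0 \<Longrightarrow> (\<Sum>j\<in>J. w j * P n (y j)) = 0"
  shows "(\<Sum>j\<in>J. w j * (P m (y j) * P n (y j))) =
    (if m = n then (\<Sum>j\<in>J. w j) * (\<Prod>l = 1..n. \<gamma> l) else 0)"
proof -
  define F where "F m n = (\<Sum>j\<in>J. w j * (P m (y j) * P n (y j)))" for m n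
  define h where "h n = (\<Sum>j\<in>J. w j) * (\<Prod>l = 1..n. \<gamma> l)" for n
  have h_Suc: "h (Suc n) = \<gamma> (Suc n) * h n" for n
    by (simp add: h_def)
  have F_0: "F 0 n = (if 0 = n then h n else 0)" for n
    using sum_0[of n] by (auto simp: F_def h_def P_0)
  \<comment> \<open>Multiplication by \<open>x\<close> is self-adjoint: expand \<open>x * P m x * P n x\<close> by either recurrence.\<close>
  have F_Suc: "F (Suc m) n =
      F m (Suc n) + (\<alpha> n - \<alpha> m) * F m n + \<gamma> n * F m (n - 1) - \<gamma> m * F (m - 1) n" for m n
  proof -
    have step: "P (Suc k) x = x * P k x - \<alpha> k * P k x - \<gamma> k * P (k - 1) x" for k x
      using rec[of x k] by (simp add: algebra_simps)
    show ?thesis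
      unfolding F_def sum_distrib_left sum.distrib[symmetric] sum_subtractf[symmetric]
      by (intro sum.cong refl) (simp only: step, simp add: algebra_simps)
  qed
  have "F m n = (if m = n then h n else 0)"
  proof (induction m arbitrary: n rule: less_induct)
    case (less m)
    show ?case
    proof (cases m)
      case 0
      then show ?thesis by (simp add: F_0)
    next
      case (Suc k)
      have IH: "F k n = (if k = n then h n else 0)"
        "F (k - 1) n = (if k - 1 = n then h n else 0)" for n
        using less.IH Suc by auto
      \<comment> \<open>At \<open>n = k + 1\<close> this leaves
        \<open>\<gamma> (Suc k) * h k\<close>; at \<open>n = k\<close> the difference of the
        \<alpha> is zero; at \<open>n + 1 = k\<close> the first and last terms cancel by
        \<open>h_Suc\<close>.\<close>
      show ?thesis
        unfolding Suc F_Suc IH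
        by (cases k; cases n) (auto simp: \<gamma>_0 h_Suc)
    qed
  qed
  then show ?thesis by (simp add: F_def h_def)
qed

text \<open>Passing from monomials to monic polynomials multiplies the Hankel matrix by a
  unitriangular matrix on the left and its transpose on the right, which preserves the
  determinant.\<close>

lemma hankel_det_eq_gram_det:
  fixes w x :: "'i \<Rightarrow> 'a::idom" and p :: "nat \<Rightarrow> 'a poly"
  assumes deg: "\<And>i. degree (p i) = i" and lead: "\<And>i. lead_coeff (p i) = 1"
  shows "hankel_det n (\<lambda>k. \<Sum>j\<in>J. w j * x j ^ k) =
    det (mat (n + 1) (n + 1) (\<lambda>(i, j). \<Sum>l\<in>J. w l * (poly (p i) (x l) * poly (p j) (x l))))"
proof -
  let ?H = "mat (n + 1) (n + 1) (\<lambda>(i, j). \<Sum>l\<in>J. w l * x l ^ (i + j))"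
  let ?U = "mat (n + 1) (n + 1) (\<lambda>(i, j). coeff (p i) j)"
  let ?G = "mat (n + 1) (n + 1) (\<lambda>(i, j). \<Sum>l\<in>J. w l * (poly (p i) (x l) * poly (p j) (x l)))"
  have U: "?U \<in> carrier_mat (n + 1) (n + 1)" and H: "?H \<in> carrier_mat (n + 1) (n + 1)"
    by auto
  have poly_eq: "poly (p i) z = (\<Sum>k<n + 1. coeff (p i) k * z ^ k)" if "i < n + 1" for i z
    unfolding poly_altdef using that deg[of i]
    by (intro sum.mono_neutral_left) (auto simp: coeff_eq_0)
  have "?G = ?U * ?H * transpose_mat ?U"
  proof (rule eq_matI)
    fix i j assume "i < dim_row (?U * ?H * transpose_mat ?U)"
      "j < dim_col (?U * ?H * transpose_mat ?U)"
    then have i: "i < n + 1" and j: "j < n + 1" by auto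
    have "(?U * ?H * transpose_mat ?U) $$ (i, j) =
        (\<Sum>b<n + 1. (\<Sum>a<n + 1. coeff (p i) a * (\<Sum>l\<in>J. w l * x l ^ (a + b))) * coeff (p j) b)"
      using i j by (simp add: scalar_prod_def lessThan_atLeast0 del: sum.op_ivl_Suc)
    also have "\<dots> = (\<Sum>b<n + 1. \<Sum>a<n + 1. \<Sum>l\<in>J.
        w l * ((coeff (p i) a * x l ^ a) * (coeff (p j) b * x l ^ b)))"
      by (simp add: sum_distrib_left sum_distrib_right power_add algebra_simps
          del: sum.lessThan_Suc)
    also have "\<dots> = (\<Sum>l\<in>J. \<Sum>b<n + 1. \<Sum>a<n + 1.
        w l * ((coeff (p i) a * x l ^ a) * (coeff (p j) b * x l ^ b)))"
      by (simp only: sum.swap[of _ "{..<n + 1}" J])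
    also have "\<dots> = (\<Sum>l\<in>J. w l * (poly (p i) (x l) * poly (p j) (x l)))"
      unfolding poly_eq[OF i] poly_eq[OF j]
      by (intro sum.cong refl) (subst sum_product, subst sum.swap, simp only: sum_distrib_left)
    finally show "?G $$ (i, j) = (?U * ?H * transpose_mat ?U) $$ (i, j)"
      using i j by simp
  qed auto
  moreover have "det ?U = 1"
  proof -
    have "det ?U = prod_list (diag_mat ?U)"
      by (rule det_lower_triangular[OF _ U]) (auto simp: deg coeff_eq_0)
    also have "diag_mat ?U = map (\<lambda>i. 1) [0..<n + 1]"
      unfolding diag_mat_def using deg lead by (auto intro!: map_cong simp del: upt_Suc)
    finally show ?thesis by (simp add: map_replicate_const)
  qed
  moreover have "det (?U * ?H * transpose_mat ?U) = det ?U * det ?H * det ?U"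
    using det_mult[OF mult_carrier_mat[OF U H], of "transpose_mat ?U"] det_mult[OF U H]
      det_transpose[OF U] transpose_carrier_mat[of ?U] U by metis
  ultimately show ?thesis by (simp add: hankel_det_def)
qed

section \<open>Determinants of the two sparse Gram patterns\<close>

lemma det_diagonal:
  "det (mat n n (\<lambda>(i, j). if i = j then g i else 0)) = (\<Prod>i<n. g i)"
proof -
  let ?D = "mat n n (\<lambda>(i, j). if i = j then g i else 0)"
  have "det ?D = prod_list (diag_mat ?D)"
    by (rule det_upper_triangular[of _ n]) auto
  also have "diag_mat ?D = map g [0..<n]"
    by (auto simp: diag_mat_def)
  also have "prod_list \<dots> = (\<Prod>i<n. g i)"
    by (simp add: prod.distinct_set_conv_list[symmetric] lessThan_atLeast0)
  finally show ?thesis .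
qed

lemma det_two_by_two_antidiagonal_blocks:
  fixes g :: "nat \<Rightarrow> 'a::idom"
  shows "det (mat (2 * n) (2 * n)
      (\<lambda>(i, j). if even (i + j) then 0 else if i div 2 = j div 2 then g (i div 2) else 0))
    = (\<Prod>i<n. - (g i)\<^sup>2)"
proof (induction n)
  case 0
  show ?case by simp
next
  case (Suc n)
  let ?f = "\<lambda>(i, j). if even (i + j) then 0 else if i div 2 = j div 2 then g (i div 2) else 0"
  let ?A = "mat (2 * n) (2 * n) ?f"
  let ?D = "mat 2 2 (\<lambda>(i, j). if i = j then 0 else g n)"
  have "mat (2 * Suc n) (2 * Suc n) ?f = four_block_mat ?A (0\<^sub>m (2 * n) 2) (0\<^sub>m 2 (2 * n)) ?D"
  proof (rule eq_matI)
    fix i j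
    assume "i < dim_row (four_block_mat ?A (0\<^sub>m (2 * n) 2) (0\<^sub>m 2 (2 * n)) ?D)"
      "j < dim_col (four_block_mat ?A (0\<^sub>m (2 * n) 2) (0\<^sub>m 2 (2 * n)) ?D)"
    then have ij: "i < 2 * n + 2" "j < 2 * n + 2" by auto
    consider "i < 2 * n" "j < 2 * n" | "i < 2 * n" "\<not> j < 2 * n" | "\<not> i < 2 * n" "j < 2 * n"
      | "i = 2 * n" "j = 2 * n" | "i = 2 * n" "j = 2 * n + 1"
      | "i = 2 * n + 1" "j = 2 * n" | "i = 2 * n + 1" "j = 2 * n + 1"
      using ij by linarith
    then show "mat (2 * Suc n) (2 * Suc n) ?f $$ (i, j) =
        four_block_mat ?A (0\<^sub>m (2 * n) 2) (0\<^sub>m 2 (2 * n)) ?D $$ (i, j)"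
    proof cases
      case 2
      then have "i div 2 \<noteq> j div 2" by presburger
      with 2 ij show ?thesis by simp
    next
      case 3
      then have "i div 2 \<noteq> j div 2" by presburger
      with 3 ij show ?thesis by simp
    qed simp_all
  qed simp_all
  moreover have "det (four_block_mat ?A (0\<^sub>m (2 * n) 2) (0\<^sub>m 2 (2 * n)) ?D) = det ?A * det ?D"
    by (rule det_four_block_mat_upper_right_zero) auto
  moreover have "det ?D = - (g n)\<^sup>2"
  proof -
    have "?D = four_block_mat (0\<^sub>m 1 1) (mat 1 1 (\<lambda>_. g n)) (mat 1 1 (\<lambda>_. g n)) (0\<^sub>m 1 1)"
      by (rule eq_matI) (auto simp: less_2_cases_iff)
    then have "det ?D = (-1) ^ 1 * det (mat 1 1 (\<lambda>_. g n)) * det (mat 1 1 (\<lambda>_. g n))"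
      by (simp only:) (rule det_four_block_mat_lower_right_zero_col; simp)
    then show ?thesis by (simp add: det_single power2_eq_square)
  qed
  ultimately show ?case using Suc.IH by simp
qed

section \<open>Continuous dual Hahn polynomials\<close>

definition square_newton :: "real \<Rightarrow> nat \<Rightarrow> real poly" where
  "square_newton a k = (\<Prod>i<k. [:- (real i + a)\<^sup>2, 1:])"

text \<open>The factor that the Newton moments gain from \<open>k = i\<close> to
  \<open>k = i + 1\<close>. The extra \<open>1 / 2\<close> is the half step of the averaging
  identities, and \<open>c\<close> will be half of \<open>s\<close>.\<close>

definition dual_hahn_factor :: "real \<Rightarrow> real \<Rightarrow> nat \<Rightarrow> real" where
  "dual_hahn_factor a c i = c\<^sup>2 - (real i + a + 1 / 2)\<^sup>2"

text \<open>
  The classical normalisation divides by \<open>\<Prod>i<k. dual_hahn_factor a c i\<close>, which vanishes for large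
  \<open>k\<close> when \<open>c\<close> is a half-integer; the monic form only needs the product over \<open>k \<le> i < m\<close>.
  The sign exponent is \<open>m + k\<close> instead of \<open>m - k\<close> to avoid truncated subtraction.
\<close>
definition dual_hahn_coeff :: "real \<Rightarrow> real \<Rightarrow> nat \<Rightarrow> nat \<Rightarrow> real" where
  "dual_hahn_coeff a c m k =
    (-1) ^ (m + k) * real (m choose k) * (\<Prod>i = k..<m. dual_hahn_factor a c i)"

text \<open>The continuous dual Hahn polynomial with parameters \<open>a\<close>,
  \<open>1 / 2 - c\<close>, \<open>1 / 2 + c\<close>, its classical variable x^2 replaced by
  \<open>- y\<close>, normalised to be monic in \<open>y\<close>.\<close>

definition dual_hahn :: "real \<Rightarrow> real \<Rightarrow> nat \<Rightarrow> real poly" where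
  "dual_hahn a c m = (\<Sum>k\<le>m. smult (dual_hahn_coeff a c m k) (square_newton a k))"

lemma degree_square_newton: "degree (square_newton a k) = k"
  unfolding square_newton_def by (subst degree_prod_eq_sum_degree) auto

lemma lead_coeff_square_newton: "lead_coeff (square_newton a k) = 1"
  unfolding square_newton_def by (subst lead_coeff_prod) auto

lemma coeff_dual_hahn_self: "coeff (dual_hahn a c m) m = 1"
proof -
  have "coeff (dual_hahn a c m) m =
      (\<Sum>k\<le>m. if k = m then 1 else dual_hahn_coeff a c m k * coeff (square_newton a k) m)"
    unfolding dual_hahn_def coeff_sum
    by (intro sum.cong refl)
      (auto simp: dual_hahn_coeff_def lead_coeff_square_newton[of a m, unfolded degree_square_newton])
  also have "\<dots> = (\<Sum>k\<le>m. if k = m then 1 else 0)"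
    by (intro sum.cong refl) (auto simp: degree_square_newton intro!: coeff_eq_0)
  finally show ?thesis by simp
qed

lemma degree_dual_hahn: "degree (dual_hahn a c m) = m"
proof (rule antisym)
  show "degree (dual_hahn a c m) \<le> m"
    unfolding dual_hahn_def
    by (intro degree_sum_le) (auto intro: order_trans[OF degree_smult_le] simp: degree_square_newton)
  show "m \<le> degree (dual_hahn a c m)"
    by (rule le_degree) (simp add: coeff_dual_hahn_self)
qed

lemma lead_coeff_dual_hahn: "lead_coeff (dual_hahn a c m) = 1"
  by (simp add: degree_dual_hahn coeff_dual_hahn_self)

text \<open>Compares the coefficients of \<open>square_newton a k\<close> in the three-term
  recurrence. Once the common sign and product are taken out, an identity between two neighbouring
  binomials remains.\<close>

lemma dual_hahn_coeff_recurrence: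
  assumes "k \<le> Suc m"
  shows "(real k + a)\<^sup>2 * dual_hahn_coeff a c m k +
      (if k = 0 then 0 else dual_hahn_coeff a c m (k - 1)) =
    dual_hahn_coeff a c (Suc m) k +
    (dual_hahn_factor a c m - (real m)\<^sup>2 + a\<^sup>2) * dual_hahn_coeff a c m k +
    - ((real m)\<^sup>2 * dual_hahn_factor a c (m - 1)) * dual_hahn_coeff a c (m - 1) k"
proof (cases "k = Suc m")
  case True
  then show ?thesis by (simp add: dual_hahn_coeff_def binomial_eq_0 flip: power_add)
next
  case False
  with assms have k: "k \<le> m" by simp
  define e where "e = dual_hahn_factor a c"
  define C where "C = real (m choose k)"
  \<comment> \<open>\<open>B\<close> must be 0 at \<open>k = 0\<close>, where the truncated
    \<open>k - 1\<close> would give 1.\<close>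
  define B where "B = (if k = 0 then 0 else real (m choose (k - 1)))"
  define S :: real where "S = (-1) ^ (m + k)"
  define E where "E = (\<Prod>i = k..<m. e i)"
  have current: "dual_hahn_coeff a c m k = S * C * E"
    by (simp add: dual_hahn_coeff_def S_def C_def E_def e_def)
  have next_m: "dual_hahn_coeff a c (Suc m) k = - S * (C + B) * E * e m"
    using k by (cases k) (simp_all add: dual_hahn_coeff_def S_def C_def B_def E_def e_def)
  have shifted: "(if k = 0 then 0 else dual_hahn_coeff a c m (k - 1)) = - S * B * e (k - 1) * E"
    using k by (cases k)
      (simp_all add: dual_hahn_coeff_def S_def B_def E_def e_def prod.atLeast_Suc_lessThan)
  have previous: "(real m)\<^sup>2 * e (m - 1) * dual_hahn_coeff a c (m - 1) k =
      - S * (real m * (real m - real k) * C) * E"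
  proof (cases "k = m")
    case True
    then show ?thesis by (cases m) (simp_all add: dual_hahn_coeff_def)
  next
    case False
    with k obtain n where n: "m = Suc n" "k \<le> n" by (cases m) auto
    have "real (n choose k) * real m = (real m - real k) * C"
      using arg_cong[OF binomial_absorb_comp[of m k], of real] n
      unfolding of_nat_mult of_nat_diff[OF k] C_def by (simp add: mult.commute)
    moreover have "(real m)\<^sup>2 * e (m - 1) * dual_hahn_coeff a c (m - 1) k =
        - S * (real m * (real (n choose k) * real m)) * E"
      using n by (simp add: dual_hahn_coeff_def S_def E_def e_def power2_eq_square)
    ultimately show ?thesis by (simp add: mult.assoc)
  qed
  have absorb: "real k * C = (real m - real k + 1) * B"
  proof (cases k)
    case (Suc l)
    have "Suc l * (m choose Suc l) = (m - l) * (m choose l)"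
      using binomial_absorption[of l m] binomial_absorb_comp[of m l] by simp
    then have "real (Suc l) * real (m choose Suc l) = real (m - l) * real (m choose l)"
      by (metis of_nat_mult)
    then show ?thesis using Suc k by (simp add: C_def B_def of_nat_diff)
  qed (simp add: B_def)
  \<comment> \<open>A difference of squares: its factor \<open>m - k + 1\<close> is what
    \<open>absorb\<close> needs to trade \<open>B\<close> for \<open>k * C\<close>.\<close>
  have "B * (e (k - 1) - e m) = B * ((real m - real k + 1) * (real m + real k + 2 * a))"
    by (cases k) (simp_all add: B_def e_def dual_hahn_factor_def power2_eq_square algebra_simps)
  also have "\<dots> = real k * C * (real m + real k + 2 * a)"
    by (simp add: absorb)
  finally have "(real k + a)\<^sup>2 * C - B * e (k - 1) =
      - (C + B) * e m + (e m - (real m)\<^sup>2 + a\<^sup>2) * C + real m * (real m - real k) * C"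
    by (simp add: power2_eq_square algebra_simps)
  then have "S * E * ((real k + a)\<^sup>2 * C - B * e (k - 1)) = S * E *
      (- (C + B) * e m + (e m - (real m)\<^sup>2 + a\<^sup>2) * C + real m * (real m - real k) * C)"
    by simp
  then show ?thesis
    using previous unfolding current next_m shifted e_def[symmetric]
    by (simp add: algebra_simps)
qed

lemma poly_dual_hahn_extend:
  assumes "m \<le> n"
  shows "poly (dual_hahn a c m) x =
    (\<Sum>k\<le>n. dual_hahn_coeff a c m k * poly (square_newton a k) x)"
  unfolding dual_hahn_def poly_sum poly_smult using assms
  by (intro sum.mono_neutral_left) (auto simp: dual_hahn_coeff_def binomial_eq_0)

text \<open>Multiplication by \<open>x\<close> sends the Newton polynomial \<open>N k\<close> to
  \<open>N (k + 1) + (k + a)^2 * N k\<close>. At \<open>m = 0\<close> the factor \<open>m^2\<close>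
  removes the term with the truncated index \<open>m - 1\<close>.\<close>

lemma dual_hahn_three_term:
  "x * poly (dual_hahn a c m) x = poly (dual_hahn a c (Suc m)) x +
    (dual_hahn_factor a c m - (real m)\<^sup>2 + a\<^sup>2) * poly (dual_hahn a c m) x +
    - ((real m)\<^sup>2 * dual_hahn_factor a c (m - 1)) * poly (dual_hahn a c (m - 1)) x"
proof -
  let ?r = "dual_hahn_coeff a c" and ?N = "\<lambda>k. poly (square_newton a k) x"
  have N: "x * ?N k = ?N (Suc k) + (real k + a)\<^sup>2 * ?N k" for k
    by (simp add: square_newton_def algebra_simps)
  have "x * poly (dual_hahn a c m) x = (\<Sum>k\<le>m. ?r m k * (x * ?N k))"
    by (simp add: poly_dual_hahn_extend[OF order_refl] sum_distrib_left mult.left_commute)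
  also have "\<dots> = (\<Sum>k\<le>m. ?r m k * ?N (Suc k)) + (\<Sum>k\<le>m. (real k + a)\<^sup>2 * ?r m k * ?N k)"
    by (simp only: N) (simp add: sum.distrib algebra_simps)
  also have "(\<Sum>k\<le>m. ?r m k * ?N (Suc k)) =
      (\<Sum>k\<le>Suc m. (if k = 0 then 0 else ?r m (k - 1)) * ?N k)"
    by (subst sum.atMost_Suc_shift) simp
  also have "(\<Sum>k\<le>m. (real k + a)\<^sup>2 * ?r m k * ?N k) = (\<Sum>k\<le>Suc m. (real k + a)\<^sup>2 * ?r m k * ?N k)"
    by (simp add: dual_hahn_coeff_def)
  also have "(\<Sum>k\<le>Suc m. (if k = 0 then 0 else ?r m (k - 1)) * ?N k) + \<dots> =
      (\<Sum>k\<le>Suc m. ((real k + a)\<^sup>2 * ?r m k + (if k = 0 then 0 else ?r m (k - 1))) * ?N k)"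
    unfolding sum.distrib[symmetric] by (intro sum.cong refl) (simp add: algebra_simps)
  also have "\<dots> = (\<Sum>k\<le>Suc m. (?r (Suc m) k +
      (dual_hahn_factor a c m - (real m)\<^sup>2 + a\<^sup>2) * ?r m k +
      - ((real m)\<^sup>2 * dual_hahn_factor a c (m - 1)) * ?r (m - 1) k) * ?N k)"
    by (intro sum.cong refl, subst dual_hahn_coeff_recurrence) auto
  also have "\<dots> = poly (dual_hahn a c (Suc m)) x +
    (dual_hahn_factor a c m - (real m)\<^sup>2 + a\<^sup>2) * poly (dual_hahn a c m) x +
    - ((real m)\<^sup>2 * dual_hahn_factor a c (m - 1)) * poly (dual_hahn a c (m - 1)) x"
    unfolding poly_dual_hahn_extend[OF order_refl, of _ _ "Suc m"]
      poly_dual_hahn_extend[of m "Suc m", OF le_SucI[OF order_refl]]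
      poly_dual_hahn_extend[of "m - 1" "Suc m", OF le_SucI[OF diff_le_self]]
      sum_distrib_left sum.distrib[symmetric]
    by (intro sum.cong refl) (simp add: algebra_simps)
  finally show ?thesis .
qed

text \<open>The moment product over \<open>i < k\<close> completes the coefficient product over
  \<open>k \<le> i < m\<close> to one independent of \<open>k\<close>; what is left is the expansion
  of (1 - 1)^m.\<close>

lemma sum_dual_hahn_eq_0:
  fixes w y :: "'i \<Rightarrow> real"
  assumes moments: "\<And>k. (\<Sum>j\<in>J. w j * poly (square_newton a k) (y j)) =
      M * (\<Prod>i<k. dual_hahn_factor a c i)"
    and m: "m > 0"
  shows "(\<Sum>j\<in>J. w j * poly (dual_hahn a c m) (y j)) = 0"
proof -
  let ?e = "dual_hahn_factor a c"
  have "(\<Sum>j\<in>J. w j * poly (dual_hahn a c m) (y j)) =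
      (\<Sum>k\<le>m. dual_hahn_coeff a c m k * (\<Sum>j\<in>J. w j * poly (square_newton a k) (y j)))"
    unfolding dual_hahn_def poly_sum poly_smult sum_distrib_left
    by (subst sum.swap) (simp add: mult.left_commute)
  also have "\<dots> = (\<Sum>k\<le>m. ((-1) ^ m * M * (\<Prod>i<m. ?e i)) * ((-1) ^ k * real (m choose k)))"
  proof (intro sum.cong refl)
    fix k assume "k \<in> {..m}"
    then have "(\<Prod>i<m. ?e i) = (\<Prod>i<k. ?e i) * (\<Prod>i = k..<m. ?e i)"
      by (simp add: lessThan_atLeast0 prod.atLeastLessThan_concat)
    then show "dual_hahn_coeff a c m k * (\<Sum>j\<in>J. w j * poly (square_newton a k) (y j)) =
        ((-1) ^ m * M * (\<Prod>i<m. ?e i)) * ((-1) ^ k * real (m choose k))"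
      by (simp add: moments dual_hahn_coeff_def power_add algebra_simps)
  qed
  also have "\<dots> = 0"
    unfolding sum_distrib_left[symmetric] using choose_alternating_sum[of m, where ?'a = real] m by simp
  finally show ?thesis .
qed

section \<open>Half-step averages of the Newton basis\<close>

lemma prod_dual_hahn_factor:
  "(\<Prod>i<k. dual_hahn_factor a c i) = poly (square_newton (a + 1 / 2) k) (c\<^sup>2)"
  by (simp add: square_newton_def poly_prod dual_hahn_factor_def algebra_simps)

lemma poly_square_newton_0: "poly (square_newton a 0) y = 1"
  by (simp add: square_newton_def)

lemma poly_square_newton_Suc:
  "poly (square_newton a (Suc k)) y = poly (square_newton a k) y * (y - (real k + a)\<^sup>2)"
  by (simp add: square_newton_def algebra_simps)

text \<open>The node 0 contributes the factor \<open>y\<close>, which links offset 0 to offset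
  1.\<close>

lemma square_newton_0_Suc: "poly (square_newton 0 (Suc k)) y = y * poly (square_newton 1 k) y"
  by (induction k) (simp_all add: poly_square_newton_0 poly_square_newton_Suc add.commute)

text \<open>As a polynomial in \<open>x\<close>, the product with offset \<open>1 / 2\<close> has
  half-integer roots. A half-step shift moves them to consecutive integers, symmetric about 0 but
  for one root; adding the mirror image removes the asymmetry.\<close>

lemma mean_square_newton_half:
  "2 * poly (square_newton 0 k) (x\<^sup>2) =
    poly (square_newton (1 / 2) k) ((x + 1 / 2)\<^sup>2) + poly (square_newton (1 / 2) k) ((x - 1 / 2)\<^sup>2)"
proof (cases k)
  case 0
  then show ?thesis by (simp add: square_newton_def)
next
  case (Suc n)
  \<comment> \<open>As polynomials in \<open>z\<close>, both sides have the roots -n, ..., n +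
    1.\<close>
  have shift: "poly (square_newton (1 / 2) (Suc n)) ((z - 1 / 2)\<^sup>2) =
      (z - (real n + 1)) * z * poly (square_newton 1 n) (z\<^sup>2)" for z
    proof (induction n)
    case 0
    show ?case by (simp add: poly_square_newton_0 poly_square_newton_Suc power2_eq_square algebra_simps)
  next
    case (Suc n)
    have step: "poly (square_newton (1 / 2) (Suc (Suc n))) ((z - 1 / 2)\<^sup>2) =
        (z - (real n + 1)) * z * poly (square_newton 1 n) (z\<^sup>2) *
        ((z - 1 / 2)\<^sup>2 - (real (Suc n) + 1 / 2)\<^sup>2)"
      unfolding Suc.IH[symmetric] by (rule poly_square_newton_Suc)
    show ?case
      unfolding step poly_square_newton_Suc[of 1 n] by (simp add: power2_eq_square algebra_simps)
  qed
  show ?thesis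
    using shift[of x] shift[of "- x"] unfolding Suc square_newton_0_Suc
    by (simp add: power2_eq_square algebra_simps)
qed

text \<open>The same mechanism for an odd polynomial: after a half-step shift its roots run through
  the half-integers from \<open>- k + 1 / 2\<close> to \<open>k + 1 / 2\<close>.\<close>

lemma mean_square_newton_one:
  "2 * (x * poly (square_newton (1 / 2) k) (x\<^sup>2)) =
    (x + 1 / 2) * poly (square_newton 1 k) ((x + 1 / 2)\<^sup>2) +
    (x - 1 / 2) * poly (square_newton 1 k) ((x - 1 / 2)\<^sup>2)"
proof -
  have shift: "(z - 1 / 2) * poly (square_newton 1 k) ((z - 1 / 2)\<^sup>2) =
      (z - (real k + 1 / 2)) * poly (square_newton (1 / 2) k) (z\<^sup>2)" for z
    proof (induction k)
    case 0
    show ?case by (simp add: poly_square_newton_0)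
  next
    case (Suc k)
    have step: "(z - 1 / 2) * poly (square_newton 1 (Suc k)) ((z - 1 / 2)\<^sup>2) =
        (z - (real k + 1 / 2)) * poly (square_newton (1 / 2) k) (z\<^sup>2) *
        ((z - 1 / 2)\<^sup>2 - (real k + 1)\<^sup>2)"
      unfolding Suc.IH[symmetric] poly_square_newton_Suc by simp
    show ?case
      unfolding step poly_square_newton_Suc[of "1 / 2" k] by (simp add: power2_eq_square field_simps)
  qed
  show ?thesis
    using shift[of x] shift[of "- x"] by (simp add: power2_eq_square algebra_simps)
qed

section \<open>Moments of the centred alternating measure\<close>

lemma alternating_telescope:
  fixes f :: "nat \<Rightarrow> real"
  shows "(\<Sum>j = 1..s. (-1) ^ (j - 1) * (f (j - 1) + f j)) = f 0 - (-1) ^ s * f s"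
  by (induction s) (simp_all add: algebra_simps)

text \<open>The points \<open>j - (s + 1) / 2\<close> are the midpoints of the unit grid from -s/2
  to s/2, so the alternating sum of means of \<open>Q\<close> telescopes to the two ends.\<close>

lemma alternating_sum_mean:
  fixes g Q :: "real \<Rightarrow> real"
  assumes "\<And>x. 2 * g x = Q (x + 1 / 2) + Q (x - 1 / 2)"
  shows "2 * (\<Sum>j = 1..s. (-1) ^ (j - 1) * g (real j - (real s + 1) / 2)) =
    Q (- (real s / 2)) - (-1) ^ s * Q (real s / 2)"
proof -
  have "2 * (\<Sum>j = 1..s. (-1) ^ (j - 1) * g (real j - (real s + 1) / 2)) =
      (\<Sum>j = 1..s. (-1) ^ (j - 1) * (Q (real (j - 1) - real s / 2) + Q (real j - real s / 2)))"
    unfolding sum_distrib_left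
  proof (intro sum.cong refl)
    fix j assume "j \<in> {1..s}"
    then have ends: "real j - (real s + 1) / 2 + 1 / 2 = real j - real s / 2"
      "real j - (real s + 1) / 2 - 1 / 2 = real (j - 1) - real s / 2"
      by (simp_all add: of_nat_diff field_simps)
    from assms[of "real j - (real s + 1) / 2"]
    have mean: "2 * g (real j - (real s + 1) / 2) =
        Q (real (j - 1) - real s / 2) + Q (real j - real s / 2)"
      unfolding ends by (simp only: add.commute)
    show "2 * ((-1) ^ (j - 1) * g (real j - (real s + 1) / 2)) =
        (-1) ^ (j - 1) * (Q (real (j - 1) - real s / 2) + Q (real j - real s / 2))"
      unfolding mean[symmetric] by (rule mult.left_commute)
  qed
  also have "\<dots> = Q (- (real s / 2)) - (-1) ^ s * Q (real s / 2)"
    by (subst alternating_telescope) simp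
  finally show ?thesis .
qed

text \<open>Replacing \<open>j\<close> by \<open>s + 1 - j\<close> negates the centred point and
  multiplies the sign by \<open>(-1) ^ (s + 1)\<close>.\<close>

lemma alternating_sum_reflect:
  "(\<Sum>j = 1..s. (-1) ^ (j - 1) * g (real j - (real s + 1) / 2)) =
    - ((-1) ^ s) * (\<Sum>j = 1..s. (-1) ^ (j - 1) * (g (- (real j - (real s + 1) / 2)) :: real))"
proof -
  have "(\<Sum>j = 1..s. (-1) ^ (j - 1) * g (real j - (real s + 1) / 2)) =
      (\<Sum>j = 1..s. (-1) ^ (s + 1 - j - 1) * g (real (s + 1 - j) - (real s + 1) / 2))"
    by (rule sum.atLeastAtMost_rev)
  also have "\<dots> = (\<Sum>j = 1..s. - ((-1) ^ s) *
      ((-1) ^ (j - 1) * g (- (real j - (real s + 1) / 2))))"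
  proof (intro sum.cong refl)
    fix j assume j: "j \<in> {1..s}"
    then obtain i k where "j = Suc i" "s = Suc (i + k)"
      by (cases j) (auto simp: le_iff_add)
    then have sign: "(-1) ^ (s + 1 - j - 1) = - ((-1) ^ s) * (-1 :: real) ^ (j - 1)"
      by (simp add: power_add flip: power_mult_distrib)
    from j have reflect: "real (s + 1 - j) - (real s + 1) / 2 = - (real j - (real s + 1) / 2)"
      by (simp add: of_nat_diff field_simps)
    show "(-1) ^ (s + 1 - j - 1) * g (real (s + 1 - j) - (real s + 1) / 2) =
        - ((-1) ^ s) * ((-1) ^ (j - 1) * g (- (real j - (real s + 1) / 2)))"
      unfolding sign reflect by (rule mult.assoc)
  qed
  finally show ?thesis by (simp add: sum_distrib_left)
qed

lemma alternating_sum_even_eq_0: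
  fixes g :: "real \<Rightarrow> real"
  assumes "even s" and "\<And>x. g (- x) = g x"
  shows "(\<Sum>j = 1..s. (-1) ^ (j - 1) * g (real j - (real s + 1) / 2)) = 0" (is "?S = 0")
proof -
  have "?S = - ((-1) ^ s) * ?S"
    using alternating_sum_reflect[of g s] unfolding assms(2) .
  then show ?thesis using assms(1) by simp
qed

lemma alternating_sum_odd_eq_0:
  fixes g :: "real \<Rightarrow> real"
  assumes "odd s" and "\<And>x. g (- x) = - g x"
  shows "(\<Sum>j = 1..s. (-1) ^ (j - 1) * g (real j - (real s + 1) / 2)) = 0" (is "?S = 0")
proof -
  have "?S = - ((-1) ^ s) * - ?S"
    using alternating_sum_reflect[of g s] unfolding assms(2) mult_minus_right sum_negf .
  then show ?thesis using assms(1) by simp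
qed

lemma moments_odd_0:
  assumes "odd s"
  shows "(\<Sum>j = 1..s. (-1) ^ (j - 1) * poly (square_newton 0 k) ((real j - (real s + 1) / 2)\<^sup>2)) =
    (\<Prod>i<k. dual_hahn_factor 0 (real s / 2) i)"
  using alternating_sum_mean[where g = "\<lambda>x. poly (square_newton 0 k) (x\<^sup>2)" and s = s
      and Q = "\<lambda>x. poly (square_newton (1 / 2) k) (x\<^sup>2)", OF mean_square_newton_half] assms
  by (simp add: prod_dual_hahn_factor)

lemma moments_odd_1:
  assumes "odd s"
  shows "(\<Sum>j = 1..s. (-1) ^ (j - 1) * (real j - (real s + 1) / 2)\<^sup>2 *
      poly (square_newton 1 k) ((real j - (real s + 1) / 2)\<^sup>2)) =
    ((real s / 2)\<^sup>2 - 1 / 4) * (\<Prod>i<k. dual_hahn_factor 1 (real s / 2) i)"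
proof -
  \<comment> \<open>The factor at \<open>i = 0\<close> is split off; the later factors for offset 0
    are those for offset 1.\<close>
  have "(\<Prod>i<Suc k. dual_hahn_factor 0 (real s / 2) i) =
      ((real s / 2)\<^sup>2 - 1 / 4) * (\<Prod>i<k. dual_hahn_factor 1 (real s / 2) i)"
    unfolding prod.lessThan_Suc_shift
    by (simp add: dual_hahn_factor_def power2_eq_square add_ac)
  with moments_odd_0[OF assms, of "Suc k"] show ?thesis
    by (simp add: square_newton_0_Suc mult.assoc)
qed

text \<open>Here \<open>Q\<close> is odd and \<open>s\<close> is even, so the boundary values
  combine to -2 Q(s/2); this is the source of the constant \<open>- (s / 2)\<close>.\<close>

lemma moments_even:
  assumes "even s"
  shows "(\<Sum>j = 1..s. (-1) ^ (j - 1) * (real j - (real s + 1) / 2) *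
      poly (square_newton (1 / 2) k) ((real j - (real s + 1) / 2)\<^sup>2)) =
    - (real s / 2) * (\<Prod>i<k. dual_hahn_factor (1 / 2) (real s / 2) i)"
  using alternating_sum_mean[where g = "\<lambda>x. x * poly (square_newton (1 / 2) k) (x\<^sup>2)" and s = s
      and Q = "\<lambda>x. x * poly (square_newton 1 k) (x\<^sup>2)", OF mean_square_newton_one] assms
  by (simp add: prod_dual_hahn_factor mult.assoc)

lemma dual_hahn_orthogonality:
  fixes w y :: "'i \<Rightarrow> real"
  assumes moments: "\<And>k. (\<Sum>j\<in>J. w j * poly (square_newton a k) (y j)) =
      M * (\<Prod>i<k. dual_hahn_factor a c i)"
  shows "(\<Sum>j\<in>J. w j * (poly (dual_hahn a c m) (y j) * poly (dual_hahn a c n) (y j))) =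
    (if m = n then M * (\<Prod>l = 1..n. - ((real l)\<^sup>2 * dual_hahn_factor a c (l - 1))) else 0)"
proof -
  have "sum w J = M"
    using moments[of 0] by (simp add: square_newton_def)
  moreover have "poly (dual_hahn a c 0) x = 1" for x
    by (simp add: dual_hahn_def dual_hahn_coeff_def square_newton_def)
  ultimately show ?thesis
    using three_term_orthogonality[where P = "\<lambda>m. poly (dual_hahn a c m)" and J = J and w = w and y = y,
        OF dual_hahn_three_term _ _ sum_dual_hahn_eq_0[OF moments], of m n]
    by simp
qed

section \<open>Hankel determinants of alternating power sums\<close>

text \<open>The centring shift \<open>d\<close> sits inside the polynomials, so the Gram matrix can
  be formed at the integers \<open>1..s\<close> themselves. Even and odd indices give polynomials
  even and odd about \<open>d\<close>.\<close>

definition interlace :: "real \<Rightarrow> (nat \<Rightarrow> real poly) \<Rightarrow> (nat \<Rightarrow> real poly) \<Rightarrow> nat \<Rightarrow> real poly" where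
  "interlace d A B i =
    (if even i then A (i div 2) \<circ>\<^sub>p [:- d, 1:]\<^sup>2 else [:- d, 1:] * (B (i div 2) \<circ>\<^sub>p [:- d, 1:]\<^sup>2))"

lemma poly_interlace:
  "poly (interlace d A B i) x =
    (if even i then poly (A (i div 2)) ((x - d)\<^sup>2) else (x - d) * poly (B (i div 2)) ((x - d)\<^sup>2))"
  by (simp add: interlace_def poly_pcompose left_diff_distrib)

lemma
  assumes "\<And>i. degree (A i) = i" "\<And>i. lead_coeff (A i) = 1"
    and "\<And>i. degree (B i) = i" "\<And>i. lead_coeff (B i) = 1"
  shows degree_interlace: "degree (interlace d A B i) = i"
    and lead_coeff_interlace: "lead_coeff (interlace d A B i) = 1"
proof -
  have sq: "degree ([:- d, 1:]\<^sup>2) = 2" "lead_coeff ([:- d, 1:]\<^sup>2) = 1"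
    by (simp add: degree_power_eq, simp add: lead_coeff_power)
  have comp: "degree (p \<circ>\<^sub>p [:- d, 1:]\<^sup>2) = 2 * degree p" "lead_coeff (p \<circ>\<^sub>p [:- d, 1:]\<^sup>2) = lead_coeff p" for p
    using sq lead_coeff_comp[of "[:- d, 1:]\<^sup>2" p] by (simp_all add: degree_pcompose)
  have "B k \<circ>\<^sub>p [:- d, 1:]\<^sup>2 \<noteq> 0" for k
    using comp(2)[of "B k"] assms(4)[of k] by auto
  then have "degree (interlace d A B i) = (if even i then 2 * (i div 2) else Suc (2 * (i div 2)))"
    unfolding interlace_def using assms
    by (simp add: comp(1) degree_mult_eq del: mult_pCons_left)
  then show "degree (interlace d A B i) = i"
    by (cases "even i") auto
  show "lead_coeff (interlace d A B i) = 1"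
    using assms(2,4)[of "i div 2"] comp(2)
    by (simp add: interlace_def lead_coeff_mult del: mult_pCons_left)
qed

lemma hankel_det_eq_interlace_gram_det:
  "hankel_det n (\<lambda>k. alt_power_sum k s) = det (mat (n + 1) (n + 1) (\<lambda>(i, j).
    \<Sum>l = 1..s. (-1) ^ (l - 1) *
      (poly (interlace d (dual_hahn a c) (dual_hahn b c) i) (real l) *
       poly (interlace d (dual_hahn a c) (dual_hahn b c) j) (real l))))"
  unfolding alt_power_sum_def
  by (rule hankel_det_eq_gram_det; rule degree_interlace lead_coeff_interlace;
      rule degree_dual_hahn lead_coeff_dual_hahn)

text \<open>By symmetry of the weight, entries of mixed parity vanish. For two odd indices the
  factors \<open>real l - d\<close> form a square that joins the weight, which changes the offset
  from 0 to 1.\<close>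

lemma hankel_det_alt_power_sum_odd:
  assumes "odd s"
  shows "hankel_det n (\<lambda>k. alt_power_sum k s) = (\<Prod>i<n + 1.
    if even i then \<Prod>l = 1..i div 2. - ((real l)\<^sup>2 * dual_hahn_factor 0 (real s / 2) (l - 1))
    else ((real s / 2)\<^sup>2 - 1 / 4) *
      (\<Prod>l = 1..i div 2. - ((real l)\<^sup>2 * dual_hahn_factor 1 (real s / 2) (l - 1))))"
proof -
  define c where "c = real s / 2"
  define d where "d = (real s + 1) / 2"
  let ?p = "interlace d (dual_hahn 0 c) (dual_hahn 1 c)"
  define h where "h i = (if even i then \<Prod>l = 1..i div 2. - ((real l)\<^sup>2 * dual_hahn_factor 0 c (l - 1))
    else (c\<^sup>2 - 1 / 4) * (\<Prod>l = 1..i div 2. - ((real l)\<^sup>2 * dual_hahn_factor 1 c (l - 1))))" for i :: nat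
  have vanish: "(\<Sum>l = 1..s. (-1) ^ (l - 1) * ((real l - d) * f ((real l - d)\<^sup>2))) = 0" for f :: "real \<Rightarrow> real"
    unfolding d_def
    by (rule alternating_sum_odd_eq_0[where g = "\<lambda>x. x * f (x\<^sup>2)"]) (simp_all add: assms)
  have "(\<Sum>l = 1..s. (-1) ^ (l - 1) * (poly (?p i) (real l) * poly (?p j) (real l))) =
      (if i = j then h i else 0)" for i j
  proof -
    consider "even i" "even j" | "odd i" "odd j" | "even i \<longleftrightarrow> odd j" by blast
    then show ?thesis
    proof cases
      case 1
      then have "i div 2 = j div 2 \<longleftrightarrow> i = j" by presburger
      with 1 dual_hahn_orthogonality[where w = "\<lambda>l. (-1) ^ (l - 1)" and M = 1 and a = 0
          and y = "\<lambda>l. (real l - d)\<^sup>2" and J = "{1..s}" and c = c, of "i div 2" "j div 2"]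
      show ?thesis
        using moments_odd_0[OF assms]
        by (simp add: poly_interlace h_def c_def d_def)
    next
      case 2
      then have "i div 2 = j div 2 \<longleftrightarrow> i = j" by presburger
      with 2 dual_hahn_orthogonality[where w = "\<lambda>l. (-1) ^ (l - 1) * (real l - d)\<^sup>2"
          and M = "c\<^sup>2 - 1 / 4" and a = 1 and c = c
          and y = "\<lambda>l. (real l - d)\<^sup>2" and J = "{1..s}", of "i div 2" "j div 2"]
      show ?thesis
        using moments_odd_1[OF assms]
        by (simp add: poly_interlace h_def c_def d_def power2_eq_square mult_ac)
    next
      case 3
      then have "i \<noteq> j" by auto
      with 3 vanish[of "\<lambda>y. poly (dual_hahn 0 c (i div 2)) y * poly (dual_hahn 1 c (j div 2)) y"]
        vanish[of "\<lambda>y. poly (dual_hahn 1 c (i div 2)) y * poly (dual_hahn 0 c (j div 2)) y"]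
      show ?thesis by (auto simp: poly_interlace mult_ac)
    qed
  qed
  then have "hankel_det n (\<lambda>k. alt_power_sum k s) =
      det (mat (n + 1) (n + 1) (\<lambda>(i, j). if i = j then h i else 0))"
    unfolding hankel_det_eq_interlace_gram_det[where a = 0 and b = 1 and c = c and d = d] by simp
  also have "\<dots> = (\<Prod>i<n + 1. h i)"
    by (rule det_diagonal)
  finally show ?thesis by (simp only: h_def c_def)
qed

text \<open>By antisymmetry of the weight, entries of equal parity vanish. A mixed entry carries
  exactly one \<open>real l - d\<close>, so a single family with offset \<open>1 / 2\<close> serves
  both parities.\<close>

lemma hankel_det_alt_power_sum_even:
  assumes "even s"
  shows "hankel_det (2 * m) (\<lambda>k. alt_power_sum k s) = 0"
    and "hankel_det (2 * m + 1) (\<lambda>k. alt_power_sum k s) = (\<Prod>i<m + 1.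
      - (- (real s / 2) *
        (\<Prod>l = 1..i. - ((real l)\<^sup>2 * dual_hahn_factor (1 / 2) (real s / 2) (l - 1))))\<^sup>2)"
proof -
  define c where "c = real s / 2"
  define d where "d = (real s + 1) / 2"
  let ?p = "interlace d (dual_hahn (1 / 2) c) (dual_hahn (1 / 2) c)"
  define g where "g i = - c * (\<Prod>l = 1..i. - ((real l)\<^sup>2 * dual_hahn_factor (1 / 2) c (l - 1)))" for i :: nat
  let ?G = "\<lambda>(i, j). if even (i + j) then 0 else if i div 2 = j div 2 then g (i div 2) else 0"
  have vanish: "(\<Sum>l = 1..s. (-1) ^ (l - 1) * f ((real l - d)\<^sup>2)) = 0" for f :: "real \<Rightarrow> real"
    unfolding d_def
    by (rule alternating_sum_even_eq_0[where g = "\<lambda>x. f (x\<^sup>2)"]) (simp_all add: assms)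
  have "(\<Sum>l = 1..s. (-1) ^ (l - 1) * (poly (?p i) (real l) * poly (?p j) (real l))) = ?G (i, j)" for i j
  proof -
    consider "even i" "even j" | "odd i" "odd j" | "even i \<longleftrightarrow> odd j" by blast
    then show ?thesis
    proof cases
      case 1
      with vanish[of "\<lambda>y. poly (dual_hahn (1 / 2) c (i div 2)) y * poly (dual_hahn (1 / 2) c (j div 2)) y"]
      show ?thesis by (simp add: poly_interlace)
    next
      case 2
      with vanish[of "\<lambda>y. y * (poly (dual_hahn (1 / 2) c (i div 2)) y * poly (dual_hahn (1 / 2) c (j div 2)) y)"]
      show ?thesis by (simp add: poly_interlace power2_eq_square mult_ac)
    next
      case 3
      have "(\<Sum>l = 1..s. (-1) ^ (l - 1) * (poly (?p i) (real l) * poly (?p j) (real l))) =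
          (\<Sum>l = 1..s. (-1) ^ (l - 1) * (real l - d) *
            (poly (dual_hahn (1 / 2) c (i div 2)) ((real l - d)\<^sup>2) *
             poly (dual_hahn (1 / 2) c (j div 2)) ((real l - d)\<^sup>2)))"
        using 3 by (intro sum.cong refl) (auto simp: poly_interlace)
      also have "\<dots> = (if i div 2 = j div 2 then g (j div 2) else 0)"
        using dual_hahn_orthogonality[where w = "\<lambda>l. (-1) ^ (l - 1) * (real l - d)" and M = "- c"
            and a = "1 / 2" and y = "\<lambda>l. (real l - d)\<^sup>2" and J = "{1..s}" and c = c,
            of "i div 2" "j div 2"] moments_even[OF assms]
        by (simp add: g_def c_def d_def)
      finally show ?thesis using 3 by auto
    qed
  qed
  then have gram: "hankel_det n (\<lambda>k. alt_power_sum k s) = det (mat (n + 1) (n + 1) ?G)" for n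
    unfolding hankel_det_eq_interlace_gram_det[where a = "1 / 2" and b = "1 / 2" and c = c and d = d]
    by simp
  \<comment> \<open>In odd size the last row is zero: the only possible partner of index
    \<open>2 * m\<close> is \<open>2 * m + 1\<close>, outside the matrix.\<close>
  have "det (mat (2 * m + 1) (2 * m + 1) ?G) =
      (\<Sum>j<2 * m + 1. mat (2 * m + 1) (2 * m + 1) ?G $$ (2 * m, j) *
        cofactor (mat (2 * m + 1) (2 * m + 1) ?G) (2 * m) j)"
    by (rule laplace_expansion_row) auto
  also have "\<dots> = 0"
  proof (intro sum.neutral ballI)
    fix j assume "j \<in> {..<2 * m + 1}"
    then have j: "j < 2 * m + 1" by simp
    then have "even j \<or> m \<noteq> j div 2" by presburger
    with j show "mat (2 * m + 1) (2 * m + 1) ?G $$ (2 * m, j) *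
        cofactor (mat (2 * m + 1) (2 * m + 1) ?G) (2 * m) j = 0"
      by auto
  qed
  finally show "hankel_det (2 * m) (\<lambda>k. alt_power_sum k s) = 0"
    unfolding gram .
  have "2 * m + 1 + 1 = 2 * (m + 1)" by simp
  then have "hankel_det (2 * m + 1) (\<lambda>k. alt_power_sum k s) = (\<Prod>i<m + 1. - (g i)\<^sup>2)"
    unfolding gram by (simp only: det_two_by_two_antidiagonal_blocks)
  then show "hankel_det (2 * m + 1) (\<lambda>k. alt_power_sum k s) = (\<Prod>i<m + 1.
      - (- (real s / 2) *
        (\<Prod>l = 1..i. - ((real l)\<^sup>2 * dual_hahn_factor (1 / 2) (real s / 2) (l - 1))))\<^sup>2)"
    by (simp only: g_def c_def)
qed

section \<open>From products of norms to the closed forms\<close>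

lemma prod_triangular_Suc:
  fixes a :: "nat \<Rightarrow> 'a::comm_semiring_1"
  shows "(\<Prod>l = 1..Suc m. a l ^ (2 * (Suc m + 1 - l))) =
    (\<Prod>l = 1..m. a l ^ (2 * (m + 1 - l))) * (\<Prod>l = 1..Suc m. a l)\<^sup>2"
proof -
  \<comment> \<open>The old exponent at \<open>l = Suc m\<close> is 0, so the old product may
    include this index.\<close>
  have "(\<Prod>l = 1..Suc m. a l ^ (2 * (Suc m + 1 - l))) =
      (\<Prod>l = 1..Suc m. a l ^ (2 * (m + 1 - l)) * (a l)\<^sup>2)"
  proof (intro prod.cong refl)
    fix l assume "l \<in> {1..Suc m}"
    then have "2 * (Suc m + 1 - l) = 2 * (m + 1 - l) + 2" by auto
    then show "a l ^ (2 * (Suc m + 1 - l)) = a l ^ (2 * (m + 1 - l)) * (a l)\<^sup>2"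
      by (simp only: power_add)
  qed
  then show ?thesis
    by (simp only: prod.distrib prod_power_distrib) simp
qed

text \<open>Each earlier exponent grows by two, while the new index enters with exponent one and so
  stays outside the square.\<close>

lemma prod_odd_triangular_Suc:
  fixes a b :: "nat \<Rightarrow> 'a::comm_semiring_1"
  shows "(\<Prod>l = 0..Suc m. b l * a l ^ (2 * (Suc m - l) + 1)) =
    (\<Prod>l = 0..m. b l * a l ^ (2 * (m - l) + 1)) * (b (Suc m) * a (Suc m) * (\<Prod>l = 0..m. a l)\<^sup>2)"
proof -
  have "(\<Prod>l = 0..m. b l * a l ^ (2 * (Suc m - l) + 1)) =
      (\<Prod>l = 0..m. b l * a l ^ (2 * (m - l) + 1) * (a l)\<^sup>2)"
  proof (intro prod.cong refl)
    fix l assume "l \<in> {0..m}"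
    then have "2 * (Suc m - l) + 1 = 2 * (m - l) + 1 + 2" by auto
    then show "b l * a l ^ (2 * (Suc m - l) + 1) = b l * a l ^ (2 * (m - l) + 1) * (a l)\<^sup>2"
      by (simp only: power_add mult.assoc)
  qed
  then show ?thesis
    by (simp add: prod.distrib prod_power_distrib mult_ac)
qed

text \<open>Both sides grow by the same product of two consecutive \<open>h\<close> from
  \<open>m\<close> to \<open>m + 1\<close>. The factors for offsets 0 and 1 are one sequence
  \<open>u\<close> with different starting points.\<close>

lemma hankel_det_alt_power_sum_odd_closed:
  fixes s m :: nat
  assumes "odd s"
  shows "hankel_det (2 * m) (\<lambda>k. alt_power_sum k s) =
      (-1) ^ m / (fact m)\<^sup>2 *
      (\<Prod>l = 1..m. ((real l)\<^sup>2 / 4 * ((real s)\<^sup>2 - (2 * real l - 1)\<^sup>2)) ^ (2 * (m + 1 - l)))" (is "?H0 = ?T m")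
    and "hankel_det (2 * m + 1) (\<lambda>k. alt_power_sum k s) =
      1 / 4 ^ (m + 1) *
      (\<Prod>l = 0..m. fact l ^ 4 / 16 ^ l * ((real s)\<^sup>2 - (2 * real l + 1)\<^sup>2) ^ (2 * (m - l) + 1))" (is "?H1 = ?S m")
proof -
  define u where "u l = ((real s)\<^sup>2 - (2 * real l - 1)\<^sup>2) / 4" for l :: nat
  define U where "U m = (\<Prod>l = 1..m. u l)" for m
  define h where "h i = (if even i then
      \<Prod>l = 1..i div 2. - ((real l)\<^sup>2 * dual_hahn_factor 0 (real s / 2) (l - 1))
    else ((real s / 2)\<^sup>2 - 1 / 4) *
      (\<Prod>l = 1..i div 2. - ((real l)\<^sup>2 * dual_hahn_factor 1 (real s / 2) (l - 1))))" for i :: nat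
  have hankel: "hankel_det n (\<lambda>k. alt_power_sum k s) = (\<Prod>i<n + 1. h i)" for n
    unfolding h_def by (rule hankel_det_alt_power_sum_odd[OF assms])
  have U_Suc: "U (Suc m) = U m * u (Suc m)" and U_0: "U 0 = 1" for m
    by (simp_all add: U_def)
  have factor: "dual_hahn_factor 0 (real s / 2) k = u (Suc k)" "dual_hahn_factor 1 (real s / 2) k = u (Suc (Suc k))" for k
    by (simp_all add: dual_hahn_factor_def u_def power2_eq_square field_simps)
  have h_even: "h (2 * m) = (-1) ^ m * (fact m)\<^sup>2 * U m" for m
    by (induction m) (simp_all add: h_def U_0 U_Suc factor power_mult_distrib)
  have h_odd: "h (2 * m + 1) = (-1) ^ m * (fact m)\<^sup>2 * U (Suc m)" for m
  proof (induction m)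
    case 0
    show ?case by (simp add: h_def U_0 U_Suc u_def power2_eq_square field_simps)
  next
    case (Suc m)
    then show ?case
      by (simp add: h_def U_Suc factor power_mult_distrib)
  qed
  have square_factor: "(real l)\<^sup>2 / 4 * ((real s)\<^sup>2 - (2 * real l - 1)\<^sup>2) = (real l)\<^sup>2 * u l" for l
    by (simp add: u_def)
  have prod_square_factor: "(\<Prod>l = 1..m. (real l)\<^sup>2 * u l) = (fact m)\<^sup>2 * U m" for m
    by (simp add: prod.distrib U_def prod_power_distrib fact_prod)
  have odd_factor: "(real s)\<^sup>2 - (2 * real l + 1)\<^sup>2 = 4 * u (Suc l)" for l
    by (simp add: u_def)
  have prod_odd_factor: "(\<Prod>l = 0..m. 4 * u (Suc l)) = 4 ^ Suc m * U (Suc m)" for m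
    by (induction m) (simp_all add: U_0 U_Suc)
  have T_Suc: "?T (Suc m) = ?T m * (h (2 * m + 1) * h (2 * Suc m))" for m
  proof -
    \<comment> \<open>Read \<open>e\<close> as \<open>(-1) ^ m\<close>, \<open>F\<close> and
      \<open>G\<close> as the factorials of \<open>m\<close> and \<open>m + 1\<close>,
      \<open>P\<close> as the old product and \<open>V\<close> as \<open>U (Suc m)\<close>.\<close>
    have step: "- e / G\<^sup>2 * (P * (G\<^sup>2 * V)\<^sup>2) = e / F\<^sup>2 * P * (e * F\<^sup>2 * V * (- e * G\<^sup>2 * V))"
      if "e\<^sup>2 = 1" "F \<noteq> 0" "G \<noteq> 0" for e F G P V :: real
      using that unfolding power2_eq_1_iff by (auto simp: field_simps power2_eq_square)
    have sign: "(-1 :: real) ^ Suc m = - ((-1) ^ m)"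
      by simp
    show ?thesis
      unfolding square_factor prod_triangular_Suc prod_square_factor h_even h_odd sign
      by (rule step) (simp_all del: fact_Suc flip: power_mult_distrib power_mult)
  qed
  have S_Suc: "?S (Suc m) = ?S m * (h (2 * Suc m) * h (2 * Suc m + 1))" for m
  proof -
    have "(16::real) ^ Suc m = (4 ^ Suc m)\<^sup>2"
      by (simp add: power2_eq_square flip: power_mult_distrib)
    then show ?thesis
      unfolding odd_factor prod_odd_triangular_Suc prod_odd_factor h_even h_odd
      by (simp add: U_Suc[of "Suc m"] field_simps eval_nat_numeral)
  qed
  have "(\<Prod>i<2 * m + 1. h i) = ?T m"
  proof (induction m)
    case 0
    show ?case by (simp add: h_def)
  next
    case (Suc m)
    have "(\<Prod>i<2 * Suc m + 1. h i) = (\<Prod>i<2 * m + 1. h i) * (h (2 * m + 1) * h (2 * Suc m))"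
      by simp
    then show ?case unfolding Suc.IH T_Suc .
  qed
  then show "?H0 = ?T m" unfolding hankel .
  have "(\<Prod>i<2 * m + 1 + 1. h i) = ?S m"
  proof (induction m)
    case 0
    show ?case using h_even[of 0] h_odd[of 0] by (simp add: U_0 U_Suc u_def)
  next
    case (Suc m)
    have "(\<Prod>i<2 * Suc m + 1 + 1. h i) = (\<Prod>i<2 * m + 1 + 1. h i) * (h (2 * Suc m) * h (2 * Suc m + 1))"
      by simp
    then show ?case unfolding Suc.IH S_Suc .
  qed
  then show "?H1 = ?S m" unfolding hankel .
qed

text \<open>Offset \<open>1 / 2\<close> gives the factors t^2 - l^2. The one with index
  \<open>l\<close> appears, squared, in the blocks \<open>i = l, ..., m\<close>, whence the exponent
  \<open>2 * (m + 1 - l)\<close>.\<close>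

lemma hankel_det_alt_power_sum_even_closed:
  "hankel_det (2 * m + 1) (\<lambda>k. alt_power_sum k (2 * t)) =
    (- ((real t)\<^sup>2)) ^ (m + 1) *
    (\<Prod>l = 1..m. ((real l)\<^sup>2 * ((real t)\<^sup>2 - (real l)\<^sup>2)) ^ (2 * (m + 1 - l)))"
proof -
  let ?f = "\<lambda>l. (real l)\<^sup>2 * ((real t)\<^sup>2 - (real l)\<^sup>2)"
  have square: "- (- (real (2 * t) / 2) *
      (\<Prod>l = 1..i. - ((real l)\<^sup>2 * dual_hahn_factor (1 / 2) (real (2 * t) / 2) (l - 1))))\<^sup>2 =
      - ((real t)\<^sup>2) * (\<Prod>l = 1..i. ?f l)\<^sup>2" for i
  proof -
    have "(\<Prod>l = 1..i. - ((real l)\<^sup>2 * dual_hahn_factor (1 / 2) (real (2 * t) / 2) (l - 1))) =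
        (\<Prod>l = 1..i. - ?f l)"
    proof (intro prod.cong refl)
      fix l assume "l \<in> {1..i}"
      then obtain k where "l = Suc k" by (cases l) auto
      then show "- ((real l)\<^sup>2 * dual_hahn_factor (1 / 2) (real (2 * t) / 2) (l - 1)) = - ?f l"
        by (simp add: dual_hahn_factor_def add_ac)
    qed
    then show ?thesis
      by (simp add: power_mult_distrib prod_power_distrib)
  qed
  have "hankel_det (2 * m + 1) (\<lambda>k. alt_power_sum k (2 * t)) =
      (\<Prod>i<m + 1. - ((real t)\<^sup>2) * (\<Prod>l = 1..i. ?f l)\<^sup>2)"
    using hankel_det_alt_power_sum_even(2)[of "2 * t" m] unfolding square by simp
  also have "\<dots> = (- ((real t)\<^sup>2)) ^ (m + 1) * (\<Prod>l = 1..m. ?f l ^ (2 * (m + 1 - l)))"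
  proof (induction m)
    case (Suc m)
    have "(\<Prod>i<Suc m + 1. - ((real t)\<^sup>2) * (\<Prod>l = 1..i. ?f l)\<^sup>2) =
        (\<Prod>i<m + 1. - ((real t)\<^sup>2) * (\<Prod>l = 1..i. ?f l)\<^sup>2) *
        (- ((real t)\<^sup>2) * (\<Prod>l = 1..Suc m. ?f l)\<^sup>2)"
      by simp
    then show ?case
      unfolding Suc.IH prod_triangular_Suc by (simp only: power_Suc add_Suc mult_ac)
  qed simp
  finally show ?thesis .
qed

theorem corollary4p5:
  fixes s :: nat
  assumes "s \<ge> 1"
  shows
    "(\<forall>t::nat. s = 2 * t \<longrightarrow>
        (\<forall>m::nat.
           hankel_det (2 * m) (\<lambda>k. alt_power_sum k s) = 0 \<and>
           hankel_det (2 * m + 1) (\<lambda>k. alt_power_sum k s) =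
             (- ((real t)\<^sup>2)) ^ (m + 1) *
             (\<Prod>l = 1..m. ((real l)\<^sup>2 * ((real t)\<^sup>2 - (real l)\<^sup>2)) ^ (2 * (m + 1 - l))) \<and>
           (m \<ge> t \<longrightarrow> hankel_det (2 * m + 1) (\<lambda>k. alt_power_sum k s) = 0)))
     \<and>
     (odd s \<longrightarrow>
        (\<forall>m::nat.
           hankel_det (2 * m) (\<lambda>k. alt_power_sum k s) =
             (-1) ^ m / (fact m)\<^sup>2 *
             (\<Prod>l = 1..m. ((real l)\<^sup>2 / 4 * ((real s)\<^sup>2 - (2 * real l - 1)\<^sup>2)) ^ (2 * (m + 1 - l))) \<and>
           hankel_det (2 * m + 1) (\<lambda>k. alt_power_sum k s) =
             1 / 4 ^ (m + 1) *
             (\<Prod>l = 0..m. fact l ^ 4 / 16 ^ l * ((real s)\<^sup>2 - (2 * real l + 1)\<^sup>2) ^ (2 * (m - l) + 1)) \<and>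
           (real m \<ge> (real s + 1) / 2 \<longrightarrow>
              hankel_det (2 * m) (\<lambda>k. alt_power_sum k s) = 0) \<and>
           (real m \<ge> (real s - 1) / 2 \<longrightarrow>
              hankel_det (2 * m + 1) (\<lambda>k. alt_power_sum k s) = 0)))"
proof (intro conjI allI impI)
  fix t m :: nat
  assume s: "s = 2 * t"
  show "hankel_det (2 * m) (\<lambda>k. alt_power_sum k s) = 0"
    using hankel_det_alt_power_sum_even(1) s by simp
  show H: "hankel_det (2 * m + 1) (\<lambda>k. alt_power_sum k s) =
      (- ((real t)\<^sup>2)) ^ (m + 1) *
      (\<Prod>l = 1..m. ((real l)\<^sup>2 * ((real t)\<^sup>2 - (real l)\<^sup>2)) ^ (2 * (m + 1 - l)))"
    unfolding s by (rule hankel_det_alt_power_sum_even_closed)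
  assume "t \<le> m"
  \<comment> \<open>This places \<open>t\<close> in the range of the product, where the factor at
    \<open>l = t\<close> is zero and has a positive exponent.\<close>
  moreover have "1 \<le> t" using assms s by simp
  ultimately show "hankel_det (2 * m + 1) (\<lambda>k. alt_power_sum k s) = 0"
    unfolding H by (auto intro!: bexI[of _ t])
next
  fix m :: nat
  assume s: "odd s"
  then obtain r where r: "s = 2 * r + 1" by (elim oddE)
  show H0: "hankel_det (2 * m) (\<lambda>k. alt_power_sum k s) =
      (-1) ^ m / (fact m)\<^sup>2 *
      (\<Prod>l = 1..m. ((real l)\<^sup>2 / 4 * ((real s)\<^sup>2 - (2 * real l - 1)\<^sup>2)) ^ (2 * (m + 1 - l)))"
    using s by (rule hankel_det_alt_power_sum_odd_closed)
  show H1: "hankel_det (2 * m + 1) (\<lambda>k. alt_power_sum k s) =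
      1 / 4 ^ (m + 1) *
      (\<Prod>l = 0..m. fact l ^ 4 / 16 ^ l * ((real s)\<^sup>2 - (2 * real l + 1)\<^sup>2) ^ (2 * (m - l) + 1))"
    using s by (rule hankel_det_alt_power_sum_odd_closed)
  show "hankel_det (2 * m) (\<lambda>k. alt_power_sum k s) = 0" if "(real s + 1) / 2 \<le> real m"
  proof -
    \<comment> \<open>The factor at \<open>l = r + 1\<close> vanishes, since there 2 l - 1 =
      s.\<close>
    have "Suc r \<le> m" using that r by simp
    then show ?thesis unfolding H0 by (auto simp: r intro!: bexI[of _ "Suc r"])
  qed
  show "hankel_det (2 * m + 1) (\<lambda>k. alt_power_sum k s) = 0" if "(real s - 1) / 2 \<le> real m"
  proof -
    \<comment> \<open>Now 2 l + 1 = s at \<open>l = r\<close>; the product starts at 0, so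
      \<open>r = 0\<close> is covered.\<close>
    have "r \<le> m" using that r by simp
    then show ?thesis unfolding H1 by (auto simp: r intro!: bexI[of _ r])
  qed
qed

end
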